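(* The richly balanced coloring problem is solved correctly by the chord node coloring (CNC) algorithm. That is, for every damping graph $\mathcal{G}=(V,V_d,E)$ (and for any choice of spanning trees and any order of applying the forcing rules in the algorithm), the CNC algorithm with input $\mathcal{G}$ returns "$\mathcal{G}$ is not PI-GAS" if there exists a coloring that renders $\mathcal{G}$ richly balanced, and returns "$\mathcal{G}$ is PI-GAS" if no such coloring exists.
   Context: A damping graph $\mathcal{G}=(V,V_d,E)$ is a finite simple connected undirected graph $(V,E)$ together with a nonempty set $V_d\subseteq V$ of damped nodes. A coloring of $\mathcal{G}$ assigns to each node one of the colors black, red, blue, every damped node being black. A black node is poorly balanced if all its neighbors are black, richly balanced if it has at least one red and at least one blue neighbor, and unbalanced otherwise. A coloring renders $\mathcal{G}$ richly balanced if there is at least one richly balanced black node and no unbalanced black node. The richly balanced coloring problem asks whether such a coloring exists. Zero forcing. Start with the damped nodes black and all other nodes white. Repeatedly: if a black node has exactly one white neighbor $w$, recolor $w$ black; stop when the rule no longer applies. $\mathcal{D}(\mathcal{G})$ denotes the final set of black nodes. Partial colorings with colors black, red, blue, white. In this setting a black node is unbalanced if it has no white neighbors and it has red neighbors or blue neighbors but not both. Forcing rules: (black forcing) if a black node $b$ has precisely one white neighbor $w$ and no red or blue neighbors, color $w$ black; (color forcing) if a black node $b$ has precisely one white neighbor $w$, at least one red (resp. blue) neighbor and no blue (resp. red) neighbors, color $w$ blue (resp. red). In either case $b$ is called a forcing node. CNC algorithm. Input: damping graph $\mathcal{G}=(V,V_d,E)$. 1. Form the (possibly disconnected) graph $\hat{\hat{\mathcal{G}}}=(V,\mathcal{D}(\mathcal{G}),\hat{\hat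 E})$, where $\hat{\hat E}$ is obtained from $E$ by deleting all edges with both endpoints in $\mathcal{D}(\mathcal{G})$. Color the nodes in $\mathcal{D}(\mathcal{G})$ black. 2. For each connected component $\hat{\hat{\mathcal{G}}}_i$ of $\hat{\hat{\mathcal{G}}}$, with node set $V_i$: find a spanning tree of $\hat{\hat{\mathcal{G}}}_i$; let $V_i^c$ be the set of nodes in $V_i\setminus\mathcal{D}(\mathcal{G})$ that are endpoints of chords (edges of the component not in the spanning tree). For each color combination in $\{\text{black},\text{blue},\text{red}\}^{|V_i^c|}$: color the nodes of $V_i^c$ according to the combination and the nodes in $V_i\setminus(\mathcal{D}(\mathcal{G})\cup V_i^c)$ white; apply repeatedly the black and color forcing rules to $\hat{\hat{\mathcal{G}}}_i$ until no forcing nodes are left; if the resulting (derived) colored graph of $\hat{\hat{\mathcal{G}}}_i$ contains no unbalanced black nodes and not all of its nodes are black, terminate and return "$\mathcal{G}$ is not PI-GAS". 3. If the loops finish without termination, return "$\mathcal{G}$ is PI-GAS". *)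

theory Defs
  imports "HOL-Library.FuncSet" "Graph_Theory.Digraph_Component"
begin

text \<open>
  Finite simple undirected graphs are the symmetric digraphs of locale \<^locale>\<open>graph\<close>: every
  undirected edge \<open>{u, v}\<close> is represented by the two arcs from \<open>u\<close> to \<open>v\<close> and from \<open>v\<close> to \<open>u\<close>.
\<close>

locale damping_graph = graph G for G :: "('a, 'b) pre_digraph" +
  fixes Vd :: "'a set"
  assumes connected: "connected G"
    and damped_subset: "Vd \<subseteq> verts G"
    and damped_nonempty: "Vd \<noteq> {}"

definition nbrs :: "('a, 'b) pre_digraph \<Rightarrow> 'a \<Rightarrow> 'a set" where
  "nbrs G v = {w. v \<rightarrow>\<^bsub>G\<^esub> w}"


section \<open>Richly balanced colorings\<close>

text \<open>\<open>White\<close> occurs only in partial colorings. Colors of non-nodes are irrelevant.\<close>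

datatype color = Black | Red | Blue | White

definition coloring :: "('a, 'b) pre_digraph \<Rightarrow> 'a set \<Rightarrow> ('a \<Rightarrow> color) \<Rightarrow> bool" where
  "coloring G Vd f \<longleftrightarrow>
     (\<forall>v \<in> verts G. f v \<in> {Black, Red, Blue}) \<and> (\<forall>v \<in> Vd. f v = Black)"

definition poorly_balanced :: "('a, 'b) pre_digraph \<Rightarrow> ('a \<Rightarrow> color) \<Rightarrow> 'a \<Rightarrow> bool" where
  "poorly_balanced G f b \<longleftrightarrow> f b = Black \<and> (\<forall>w \<in> nbrs G b. f w = Black)"

definition richly_balanced :: "('a, 'b) pre_digraph \<Rightarrow> ('a \<Rightarrow> color) \<Rightarrow> 'a \<Rightarrow> bool" where
  "richly_balanced G f b \<longleftrightarrow>
     f b = Black \<and> (\<exists>w \<in> nbrs G b. f w = Red) \<and> (\<exists>w \<in> nbrs G b. f w = Blue)"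

definition unbalanced :: "('a, 'b) pre_digraph \<Rightarrow> ('a \<Rightarrow> color) \<Rightarrow> 'a \<Rightarrow> bool" where
  "unbalanced G f b \<longleftrightarrow>
     f b = Black \<and> \<not> poorly_balanced G f b \<and> \<not> richly_balanced G f b"

definition renders_richly_balanced :: "('a, 'b) pre_digraph \<Rightarrow> ('a \<Rightarrow> color) \<Rightarrow> bool" where
  "renders_richly_balanced G f \<longleftrightarrow>
     (\<exists>b \<in> verts G. richly_balanced G f b) \<and> \<not> (\<exists>b \<in> verts G. unbalanced G f b)"


section \<open>Zero forcing\<close>

inductive zero_forcing_step :: "('a, 'b) pre_digraph \<Rightarrow> 'a set \<Rightarrow> 'a set \<Rightarrow> bool"
  for G :: "('a, 'b) pre_digraph" where
  "b \<in> B \<Longrightarrow> nbrs G b - B = {w} \<Longrightarrow> zero_forcing_step G B (insert w B)"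


section \<open>Color forcing in partially colored graphs\<close>

definition unbalanced_partial :: "('a, 'b) pre_digraph \<Rightarrow> ('a \<Rightarrow> color) \<Rightarrow> 'a \<Rightarrow> bool" where
  "unbalanced_partial G f b \<longleftrightarrow>
     f b = Black \<and> (\<forall>w \<in> nbrs G b. f w \<noteq> White) \<and>
     ((\<exists>w \<in> nbrs G b. f w = Red) \<or> (\<exists>w \<in> nbrs G b. f w = Blue)) \<and>
     \<not> ((\<exists>w \<in> nbrs G b. f w = Red) \<and> (\<exists>w \<in> nbrs G b. f w = Blue))"

inductive forcing_step :: "('a, 'b) pre_digraph \<Rightarrow> ('a \<Rightarrow> color) \<Rightarrow> ('a \<Rightarrow> color) \<Rightarrow> bool"
  for G :: "('a, 'b) pre_digraph" where
  black_forcing: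
    "b \<in> verts G \<Longrightarrow> f b = Black \<Longrightarrow> {u \<in> nbrs G b. f u = White} = {w} \<Longrightarrow>
     \<forall>u \<in> nbrs G b. f u \<noteq> Red \<Longrightarrow> \<forall>u \<in> nbrs G b. f u \<noteq> Blue \<Longrightarrow>
     forcing_step G f (f(w := Black))"
| blue_forcing:
    "b \<in> verts G \<Longrightarrow> f b = Black \<Longrightarrow> {u \<in> nbrs G b. f u = White} = {w} \<Longrightarrow>
     \<exists>u \<in> nbrs G b. f u = Red \<Longrightarrow> \<forall>u \<in> nbrs G b. f u \<noteq> Blue \<Longrightarrow>
     forcing_step G f (f(w := Blue))"
| red_forcing:
    "b \<in> verts G \<Longrightarrow> f b = Black \<Longrightarrow> {u \<in> nbrs G b. f u = White} = {w} \<Longrightarrow>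
     \<exists>u \<in> nbrs G b. f u = Blue \<Longrightarrow> \<forall>u \<in> nbrs G b. f u \<noteq> Red \<Longrightarrow>
     forcing_step G f (f(w := Red))"


section \<open>Components, spanning trees and chords\<close>

definition del_arcs_within :: "('a, 'b) pre_digraph \<Rightarrow> 'a set \<Rightarrow> ('a, 'b) pre_digraph" where
  "del_arcs_within G D = G\<lparr>arcs := {e \<in> arcs G. \<not> (tail G e \<in> D \<and> head G e \<in> D)}\<rparr>"

definition components :: "('a, 'b) pre_digraph \<Rightarrow> ('a, 'b) pre_digraph set" where
  "components G = {C. pre_digraph.max_subgraph G connected C}"

text \<open>
  \<^const>\<open>pre_digraph.cycle\<close> is a notion of directed cycle, so both orientations of a single edge form
  a cycle of length 2. Hence \<^const>\<open>forest\<close> and \<^const>\<open>spanning_tree\<close> do not fit symmetric digraphs;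
  in a simple graph, the undirected cycles are the directed ones of length at least 3.
\<close>

definition undirected_spanning_tree ::
  "('a, 'b) pre_digraph \<Rightarrow> ('a, 'b) pre_digraph \<Rightarrow> bool" where
  "undirected_spanning_tree T G \<longleftrightarrow>
     spanning T G \<and> symmetric T \<and> connected T \<and>
     \<not> (\<exists>p. pre_digraph.cycle T p \<and> 3 \<le> length p)"

definition chord_nodes ::
  "('a, 'b) pre_digraph \<Rightarrow> ('a, 'b) pre_digraph \<Rightarrow> 'a set \<Rightarrow> 'a set" where
  "chord_nodes G T D =
     {v \<in> verts G - D. \<exists>e \<in> arcs G - arcs T. v = tail G e \<or> v = head G e}"

definition initial_coloring :: "'a set \<Rightarrow> 'a set \<Rightarrow> ('a \<Rightarrow> color) \<Rightarrow> 'a \<Rightarrow> color" where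
  "initial_coloring D Vc k v = (if v \<in> D then Black else if v \<in> Vc then k v else White)"


section \<open>The CNC algorithm as a nondeterministic transition system\<close>

datatype answer = PI_GAS | Not_PI_GAS

text \<open>
  In the rules below, \<open>D\<close> is the set of black nodes produced by zero forcing, \<open>Cs\<close> the set
  of components still to be visited, \<open>C\<close> the current component, \<open>Vc\<close> its set of chord nodes, \<open>K\<close> the
  set of color combinations of \<open>Vc\<close> still to be tried, and \<open>f\<close> the current partial coloring.
\<close>

datatype ('a, 'b) config =
    Zero_Forcing "'a set"
  | Component_Loop "'a set" "('a, 'b) pre_digraph set"
  | Combination_Loop "'a set" "('a, 'b) pre_digraph set" "('a, 'b) pre_digraph"
      "'a set" "('a \<Rightarrow> color) set"
  | Color_Forcing "'a set" "('a, 'b) pre_digraph set" "('a, 'b) pre_digraph"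
      "'a set" "('a \<Rightarrow> color) set" "'a \<Rightarrow> color"
  | Returned answer

inductive cnc_step :: "('a, 'b) pre_digraph \<Rightarrow> ('a, 'b) config \<Rightarrow> ('a, 'b) config \<Rightarrow> bool"
  for G :: "('a, 'b) pre_digraph" where
  zero_force:
    "zero_forcing_step G B B' \<Longrightarrow> cnc_step G (Zero_Forcing B) (Zero_Forcing B')"
| zero_forcing_done:
    "\<not> (\<exists>B'. zero_forcing_step G D B') \<Longrightarrow>
     cnc_step G (Zero_Forcing D) (Component_Loop D (components (del_arcs_within G D)))"
| next_component:
    "C \<in> Cs \<Longrightarrow> undirected_spanning_tree T C \<Longrightarrow> Vc = chord_nodes C T D \<Longrightarrow>
     cnc_step G (Component_Loop D Cs)
       (Combination_Loop D (Cs - {C}) C Vc (Vc \<rightarrow>\<^sub>E {Black, Blue, Red}))"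
| components_done:
    "cnc_step G (Component_Loop D {}) (Returned PI_GAS)"
| next_combination:
    "k \<in> K \<Longrightarrow>
     cnc_step G (Combination_Loop D Cs C Vc K)
       (Color_Forcing D Cs C Vc (K - {k}) (initial_coloring D Vc k))"
| combinations_done:
    "cnc_step G (Combination_Loop D Cs C Vc {}) (Component_Loop D Cs)"
| color_force:
    "forcing_step C f f' \<Longrightarrow>
     cnc_step G (Color_Forcing D Cs C Vc K f) (Color_Forcing D Cs C Vc K f')"
| derived_success:
    "\<not> (\<exists>f'. forcing_step C f f') \<Longrightarrow>
     \<not> (\<exists>b \<in> verts C. unbalanced_partial C f b) \<and> \<not> (\<forall>v \<in> verts C. f v = Black) \<Longrightarrow>
     cnc_step G (Color_Forcing D Cs C Vc K f) (Returned Not_PI_GAS)"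
| derived_failure:
    "\<not> (\<exists>f'. forcing_step C f f') \<Longrightarrow>
     \<not> (\<not> (\<exists>b \<in> verts C. unbalanced_partial C f b) \<and> \<not> (\<forall>v \<in> verts C. f v = Black)) \<Longrightarrow>
     cnc_step G (Color_Forcing D Cs C Vc K f) (Combination_Loop D Cs C Vc K)"

text \<open>
  Total correctness over all runs, i.e. over all choices of spanning trees, all orders of forcing
  and all orders of processing components and combinations: no run is infinite, and whenever
  a run cannot be continued, it has returned the answer \<open>r\<close>.
\<close>

definition cnc_returns :: "('a, 'b) pre_digraph \<Rightarrow> 'a set \<Rightarrow> answer \<Rightarrow> bool" where
  "cnc_returns G Vd r \<longleftrightarrow>
     \<not> (\<exists>s. s 0 = Zero_Forcing Vd \<and> (\<forall>n :: nat. cnc_step G (s n) (s (Suc n)))) \<and>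
     (\<forall>c. (cnc_step G)\<^sup>*\<^sup>* (Zero_Forcing Vd) c \<and> \<not> (\<exists>c'. cnc_step G c c') \<longrightarrow> c = Returned r)"

end

theory Submission
  imports Defs
begin

text \<open>
  Along a run, zero forcing and color forcing only ever assign colors that every richly balanced
  coloring with the guessed chord colors must have; so a richly balanced coloring, which is not
  entirely black on some component, makes the matching combination succeed there. Conversely, all
  edges at nodes that remain white in a derived coloring are tree edges. A forest can be two-colored
  leaf by leaf so that every black node with at least two white neighbors gets neighbors of both
  colors; coloring everything outside the component black then gives a richly balanced coloring,
  where a richly balanced node is found on the boundary between black and non-black nodes because
  each component contains a node blackened by zero forcing.
\<close>

section \<open>Components of symmetric digraphs\<close>

lemma (in wf_digraph) strongly_connected_imp_connected:
  "strongly_connected G \<Longrightarrow> connected G"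
  by (auto simp: strongly_connected_def intro!: connectedI reachable_mk_symmetricI)

text \<open>Hypothesis of \<open>induced_subgraphI_arc_mono\<close>: a maximal subgraph with a
  property that survives adding arcs on the same nodes is induced, and so inherits symmetry from the
  whole graph.\<close>

lemma arc_mono_connected: "arc_mono connected"
  by (auto simp: arc_mono_def) (metis spanning_def subgraphE wf_digraph.connected_spanning_imp_connected)

text \<open>On symmetric subgraphs weak and strong connectedness coincide. The identification gives
  access to the library results on strongly connected components.\<close>

lemma (in sym_digraph) components_eq_sccs: "components G = sccs"
proof -
  have "max_subgraph strongly_connected C" if C: "max_subgraph connected C" for C
  proof -
    have ind: "induced_subgraph C G"
      using C arc_mono_connected by (rule induced_subgraphI_arc_mono)
    interpret C: wf_digraph C by (rule wf_digraphI_induced[OF ind])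
    have "strongly_connected C"
      using C.symmetric_connected_imp_strongly_connected
        induced_graph_imp_symmetric[OF sym_arcs ind] max_subgraph_prop[OF C] by blast
    moreover have "connected H" if "strongly_connected H" "subgraph H G" for H
      using that by (auto intro: wf_digraph.strongly_connected_imp_connected)
    ultimately show ?thesis
      using C by (auto simp: max_subgraph_def)
  qed
  moreover have "max_subgraph connected C" if C: "max_subgraph strongly_connected C" for C
    unfolding max_subgraph_def
  proof (intro conjI allI impI notI)
    show CG: "subgraph C G" using C by (simp add: max_subgraph_def)
    show "connected C" using C CG
      by (auto simp: max_subgraph_def intro: wf_digraph.strongly_connected_imp_connected)
    fix H assume H: "H \<noteq> C \<and> subgraph C H" and HG: "subgraph H G \<and> connected H"
    \<comment> \<open>\<open>H\<close> itself may lack reverse arcs and need not be strongly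
      connected. The subgraph induced on its nodes is symmetric, so maximality of \<open>C\<close>
      applies to it instead.\<close>
    let ?H = "G \<restriction> verts H"
    have HH: "subgraph H ?H" using HG by (blast intro: subgraph_induce_subgraphI2)
    have ind: "induced_subgraph ?H G" using HG by (intro induced_induce) auto
    interpret H: wf_digraph ?H by (rule wf_digraphI_induced[OF ind])
    have "connected ?H"
      using arc_mono_connected HH HG unfolding arc_mono_def
      by (metis induce_subgraph_verts)
    then have "strongly_connected ?H"
      using H.symmetric_connected_imp_strongly_connected
        induced_graph_imp_symmetric[OF sym_arcs ind] by blast
    moreover have "subgraph C ?H" using H HH subgraph_trans by blast
    ultimately have "?H = C"
      using C induced_imp_subgraph[OF ind] by (auto simp: max_subgraph_def)
    then have "subgraph H C" using HH by simp
    with H have "H = C"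
      by (auto simp: subgraph_def compatible_def)
    with H show False by simp
  qed
  ultimately show ?thesis by (auto simp: components_def sccs_altdef2)
qed

text \<open>The arc and its reverse make the two nodes mutually reachable, which places them in the
  same strongly connected component.\<close>

lemma (in sym_digraph) component_closed:
  assumes C: "C \<in> components G" and u: "u \<in> verts C" and uv: "u \<rightarrow>\<^bsub>G\<^esub> v"
  shows "v \<in> verts C"
proof (rule ccontr)
  assume v: "v \<notin> verts C"
  have "verts C \<in> sccs_verts"
    using C in_sccs_vertsI_sccs unfolding components_eq_sccs by blast
  moreover have "u \<rightarrow>\<^sup>* v" "v \<rightarrow>\<^sup>* u" using uv graph_symmetric by auto
  ultimately show False using u v unfolding in_sccs_verts_conv_reachable by blast
qed

lemma (in sym_digraph) component_induced:
  "C \<in> components G \<Longrightarrow> induced_subgraph C G"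
  unfolding components_eq_sccs by (rule in_sccs_imp_induced)

lemma (in sym_digraph) nbrs_component:
  assumes C: "C \<in> components G" and u: "u \<in> verts C"
  shows "nbrs C u = nbrs G u"
proof -
  have ind: "induced_subgraph C G" using C by (rule component_induced)
  then have "tail C = tail G" "head C = head G"
    by (auto simp: induced_subgraph_def subgraph_def compatible_def)
  with ind show ?thesis
    using component_closed[OF C u] u
    by (fastforce simp: nbrs_def arcs_ends_conv induced_subgraph_def)
qed

lemma (in fin_digraph) finite_sccs: "finite sccs"
  using finite_sccs_verts by (simp add: sccs_conv_sccs_verts)


section \<open>Spanning trees of undirected graphs\<close>

text \<open>Take a connected symmetric spanning subgraph with the fewest arcs. If it had a cycle of
  length at least 3, an edge of the cycle could be removed in both directions: the rest of the cycle
  and its reverse still join the endpoints.\<close>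

lemma (in graph) exists_undirected_spanning_tree:
  assumes con: "connected G"
  shows "\<exists>T. undirected_spanning_tree T G"
proof -
  define P where "P T \<longleftrightarrow> spanning T G \<and> symmetric T \<and> connected T" for T
  have "P G" using con sym_arcs subgraph_refl by (auto simp: P_def spanning_def)
  then obtain T where T: "P T" and min: "\<And>T'. P T' \<Longrightarrow> card (arcs T) \<le> card (arcs T')"
    using ex_has_least_nat[of P G "\<lambda>T. card (arcs T)"] by blast
  have sub: "subgraph T G" and vT: "verts T = verts G"
    and symT: "symmetric T" and conT: "connected T"
    using T by (auto simp: P_def spanning_def)
  interpret T: digraph T using sub by (rule digraph_subgraph)
  interpret T: sym_digraph T using symT by (rule T.sym_digraphI)
  have "\<not> (T.cycle p \<and> 3 \<le> length p)" for p
  proof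
    assume p: "T.cycle p \<and> 3 \<le> length p"
    then obtain u where u: "T.awalk u p u" "distinct (tl (T.awalk_verts u p))"
      by (auto simp: T.cycle_def)
    obtain e q where pe: "p = e # q" using p by (cases p) auto
    define v where "v = head T e"
    have e: "e \<in> arcs T" "tail T e = u" and q: "T.apath v q u"
      using u by (auto simp: pe v_def T.awalk_Cons_iff T.apath_def)
    have len: "2 \<le> length q" using p pe by simp
    \<comment> \<open>All arcs between \<open>u\<close> and \<open>v\<close> are removed, in both
      directions, so that \<open>T'\<close> stays symmetric.\<close>
    define R where "R = {a \<in> arcs T. (tail T a, head T a) \<in> {(u, v), (v, u)}}"
    define T' where "T' = T\<lparr>arcs := arcs T - R\<rparr>"
    have T'_simps [simp]: "verts T' = verts T" "arcs T' = arcs T - R"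
      "tail T' = tail T" "head T' = head T" by (auto simp: T'_def)
    interpret T': wf_digraph T' by unfold_locales auto
    have "subgraph T' T"
      by (intro subgraphI) (auto simp: compatible_def T.wf_digraph T'.wf_digraph)
    then have "spanning T' G"
      using sub vT by (auto simp: spanning_def intro: subgraph_trans)
    moreover have symT': "symmetric T'"
      unfolding symmetric_conv
    proof
      fix a assume "a \<in> arcs T'"
      then have a: "a \<in> arcs T" "a \<notin> R" by auto
      then obtain a' where "a' \<in> arcs T" "tail T a = head T a'" "head T a = tail T a'"
        using symT unfolding symmetric_conv by blast
      with a show "\<exists>a' \<in> arcs T'. tail T' a = head T' a' \<and> head T' a = tail T' a'"
        by (intro bexI[of _ a']) (auto simp: R_def)
    qed
    moreover have "strongly_connected T'"
    proof
      show "verts T' \<noteq> {}" using T.tail_in_verts[OF e(1)] by auto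
      \<comment> \<open>\<open>q\<close> is a simple path from \<open>v\<close> to \<open>u\<close>.
        An arc of \<open>R\<close> on it must lead from \<open>v\<close> to \<open>u\<close>, and
        simplicity then makes it the whole path, although \<open>q\<close> has at least two
        arcs.\<close>
      have "a \<notin> R" if "a \<in> set q" for a
      proof
        assume a: "a \<in> R"
        obtain xs ys where q_eq: "q = xs @ a # ys" using \<open>a \<in> set q\<close> by (auto simp: in_set_conv_decomp)
        have "T.apath v xs (tail T a)" and ys: "T.apath (head T a) ys u"
          and dis: "tail T a \<notin> set (T.awalk_verts (head T a) ys)"
          using q by (auto simp: q_eq T.apath_append_iff T.apath_Cons_iff)
        have "u \<in> set (T.awalk_verts (head T a) ys)"
          using ys by (auto simp: T.apath_def)
        then have "tail T a \<noteq> u" using dis by blast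
        then have au: "tail T a = v" "head T a = u" using a by (auto simp: R_def)
        have "xs = []"
          using \<open>T.apath v xs (tail T a)\<close> au T.apath_nonempty_ends by metis
        moreover have "ys = []"
          using ys au T.apath_nonempty_ends by metis
        ultimately show False using len q_eq by simp
      qed
      then have "T'.awalk v q u"
        using q unfolding T.apath_def T.awalk_def T'.awalk_def
        using compatible_cas[of T T'] by (auto simp: compatible_def)
      then have vu: "v \<rightarrow>\<^sup>*\<^bsub>T'\<^esub> u" by (rule T'.reachable_awalkI)
      then have uv: "u \<rightarrow>\<^sup>*\<^bsub>T'\<^esub> v" by (rule symmetric_reachable[OF symT'])
      have step: "x \<rightarrow>\<^sup>*\<^bsub>T'\<^esub> y" if xy: "x \<rightarrow>\<^bsub>T\<^esub> y" for x y
      proof -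
        obtain a where "a \<in> arcs T" "tail T a = x" "head T a = y" using xy by auto
        then show ?thesis
          using uv vu T'.dominatesI[of a x y]
          by (cases "a \<in> R") (auto simp: R_def arc_to_ends_def)
      qed
      have "strongly_connected T"
        using symT conT by (rule T.symmetric_connected_imp_strongly_connected)
      moreover have "x \<rightarrow>\<^sup>*\<^bsub>T'\<^esub> y" if "x \<rightarrow>\<^sup>*\<^bsub>T\<^esub> y" for x y
        using that by (induct rule: T.reachable_induct) (auto intro: step T'.reachable_trans)
      ultimately show "x \<rightarrow>\<^sup>*\<^bsub>T'\<^esub> y" if "x \<in> verts T'" "y \<in> verts T'" for x y
        using that by (auto simp: strongly_connected_def)
    qed
    ultimately have "P T'"
      using T'.strongly_connected_imp_connected by (auto simp: P_def)
    then have "card (arcs T) \<le> card (arcs T')" by (rule min)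
    moreover have "arcs T' \<subset> arcs T" using e by (auto simp: R_def v_def)
    ultimately show False using psubset_card_mono[OF T.finite_arcs, of "arcs T'"] by linarith
  qed
  then show ?thesis
    using T by (auto simp: undirected_spanning_tree_def P_def)
qed

text \<open>Take a longest simple path inside \<open>S\<close>. A neighbor in \<open>S\<close> of
  its start \<open>u\<close> lies on the path, since otherwise the path could be extended, and it is
  the second node, since otherwise a cycle of length at least 3 would close. Arbitrary
  \<open>S\<close> is allowed because leaves are removed one after another.\<close>

lemma (in graph) exists_leaf:
  assumes acyc: "\<not> (\<exists>p. cycle p \<and> 3 \<le> length p)"
    and S: "S \<subseteq> verts G" "S \<noteq> {}"
  shows "\<exists>v \<in> S. \<forall>x \<in> S. \<forall>y \<in> S. v \<rightarrow>\<^bsub>G\<^esub> x \<and> v \<rightarrow>\<^bsub>G\<^esub> y \<longrightarrow> x = y"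
proof -
  define P where "P = (\<lambda>(u, p, v). apath u p v \<and> set (awalk_verts u p) \<subseteq> S)"
  obtain s where "s \<in> S" using S by blast
  then have "P (s, [], s)" using S by (auto simp: P_def apath_Nil_iff)
  moreover have "length (fst (snd t)) < card (verts G)" if "P t" for t
    using that by (auto simp: P_def dest: length_apath_less)
  ultimately obtain t where t: "P t"
    and max: "\<And>t'. P t' \<Longrightarrow> length (fst (snd t')) \<le> length (fst (snd t))"
    using ex_has_greatest_nat[of P _ "\<lambda>t. length (fst (snd t))" "card (verts G)"]
    by (metis less_imp_le)
  obtain u p v where tp: "t = (u, p, v)" by (cases t)
  have p: "apath u p v" "set (awalk_verts u p) \<subseteq> S" using t by (auto simp: P_def tp)
  have uS: "u \<in> S" using p by (auto simp: set_awalk_verts apath_def)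
  have first: "p \<noteq> [] \<and> x = head G (hd p)" if "x \<in> S" "u \<rightarrow>\<^bsub>G\<^esub> x" for x
  proof -
    have "x \<rightarrow>\<^bsub>G\<^esub> u" using that graph_symmetric by blast
    then obtain a where a: "a \<in> arcs G" "tail G a = x" "head G a = u" by auto
    have "x \<in> set (awalk_verts u p)"
    proof (rule ccontr)
      assume "x \<notin> set (awalk_verts u p)"
      then have "P (x, a # p, v)"
        using a p \<open>x \<in> S\<close> by (auto simp: P_def apath_Cons_iff)
      then show False using max tp by fastforce
    qed
    moreover have "awalk u p v" using p by (simp add: apath_def)
    ultimately obtain q r where qr: "p = q @ r" "awalk u q x"
      using awalk_decomp by blast
    have "q \<noteq> []" using qr(2) a no_loops[of a] by (auto simp: awalk_Nil_iff)
    \<comment> \<open>The arc \<open>a\<close> from \<open>x\<close> back to \<open>u\<close> closes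
      the initial segment \<open>q\<close> to a cycle with one more arc.\<close>
    moreover have "\<not> 2 \<le> length q"
    proof
      assume "2 \<le> length q"
      have "awlast u q = x" using qr(2) by auto
      then have "apath u q x" using p(1) qr(1) by (simp add: apath_append_iff)
      then have "cycle (a # q)"
        using a qr(2) by (auto simp: cycle_def awalk_Cons_iff apath_def)
      then show False using acyc \<open>2 \<le> length q\<close> by auto
    qed
    ultimately obtain b where "q = [b]"
      by (metis One_nat_def Suc_1 Suc_leI le_neq_implies_less length_0_conv length_Suc_conv neq0_conv not_less)
    then show ?thesis using qr by (auto simp: awalk_simps)
  qed
  then show ?thesis using uS by (metis)
qed

text \<open>
  Remove a leaf; if it lies in \<open>W\<close>, its color only matters for its unique neighbor, and it is chosen
  opposite to that of some other node of \<open>W\<close> adjacent to that neighbor.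
\<close>

lemma two_coloring_by_leaves:
  fixes r :: "'a \<Rightarrow> 'a \<Rightarrow> bool"
  assumes "finite S" and sym: "\<And>x y. r x y \<Longrightarrow> r y x"
    and leaf: "\<And>S'. S' \<subseteq> S \<Longrightarrow> S' \<noteq> {} \<Longrightarrow>
      \<exists>v \<in> S'. \<forall>x \<in> S'. \<forall>y \<in> S'. r v x \<and> r v y \<longrightarrow> x = y"
  shows "\<exists>h :: 'a \<Rightarrow> bool. \<forall>b \<in> S - W. \<forall>x \<in> S \<inter> W. \<forall>y \<in> S \<inter> W. r b x \<and> r b y \<and> x \<noteq> y \<longrightarrow>
    (\<exists>z \<in> S \<inter> W. r b z \<and> h z) \<and> (\<exists>z \<in> S \<inter> W. r b z \<and> \<not> h z)"
  using assms(1) leaf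
proof (induction "card S" arbitrary: S)
  case 0
  then show ?case by auto
next
  case (Suc n)
  then have "S \<noteq> {}" by auto
  then obtain v where v: "v \<in> S" and vleaf: "\<And>x y. x \<in> S \<Longrightarrow> y \<in> S \<Longrightarrow> r v x \<Longrightarrow> r v y \<Longrightarrow> x = y"
    using Suc.prems(2)[of S] by auto
  let ?S = "S - {v}"
  have "n = card ?S" using Suc v by simp
  then obtain h where h: "\<And>b x y. b \<in> ?S - W \<Longrightarrow> x \<in> ?S \<inter> W \<Longrightarrow> y \<in> ?S \<inter> W \<Longrightarrow> r b x \<Longrightarrow> r b y \<Longrightarrow> x \<noteq> y \<Longrightarrow>
    (\<exists>z \<in> ?S \<inter> W. r b z \<and> h z) \<and> (\<exists>z \<in> ?S \<inter> W. r b z \<and> \<not> h z)"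
    using Suc.hyps(1)[of ?S] Suc.prems(1) Suc.prems(2)
    by (smt (verit) Diff_subset finite_Diff order_trans)
  show ?case
  proof (cases "v \<in> W")
    case False
    show ?thesis
    proof (intro exI[of _ h] ballI impI)
      fix b x y assume A: "b \<in> S - W" "x \<in> S \<inter> W" "y \<in> S \<inter> W" "r b x \<and> r b y \<and> x \<noteq> y"
      \<comment> \<open>The leaf \<open>v\<close> has at most one neighbor in \<open>S\<close>,
        whereas \<open>b\<close> has two.\<close>
      then have "b \<noteq> v" using vleaf by blast
      then show "(\<exists>z \<in> S \<inter> W. r b z \<and> h z) \<and> (\<exists>z \<in> S \<inter> W. r b z \<and> \<not> h z)"
        using h[of b x y] A False by blast
    qed
  next
    case True
    \<comment> \<open>If \<open>Z\<close> is empty, the choice below is arbitrary but harmless: a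
      \<open>b\<close> adjacent to \<open>v\<close> with two distinct neighbors in \<open>W\<close>
      would put one of them into \<open>Z\<close>.\<close>
    define Z where "Z = {z \<in> ?S \<inter> W. \<exists>b \<in> S - W. r b v \<and> r b z}"
    define g where "g = h(v := (\<not> h (SOME z. z \<in> Z)))"
    show ?thesis
    proof (intro exI[of _ g] ballI impI)
      fix b x y assume A: "b \<in> S - W" "x \<in> S \<inter> W" "y \<in> S \<inter> W" "r b x \<and> r b y \<and> x \<noteq> y"
      show "(\<exists>z \<in> S \<inter> W. r b z \<and> g z) \<and> (\<exists>z \<in> S \<inter> W. r b z \<and> \<not> g z)"
      proof (cases "r b v")
        case bv: True
        have "\<exists>z. z \<in> Z" using A bv unfolding Z_def by blast
        then have z: "(SOME z. z \<in> Z) \<in> Z" by (rule someI_ex)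
        then obtain b' where "b' \<in> S - W" "r b' v" "r b' (SOME z. z \<in> Z)"
          by (auto simp: Z_def)
        \<comment> \<open>Both are neighbors of the leaf \<open>v\<close>, so the node chosen from
          \<open>Z\<close> is adjacent to the very \<open>b\<close> in question.\<close>
        moreover from this have "b' = b" using vleaf sym A bv by blast
        ultimately show ?thesis
          using z bv v True unfolding g_def Z_def by (cases "h (SOME z. z \<in> Z)") (auto simp: Z_def)
      next
        case False
        then have "b \<in> ?S - W" "x \<in> ?S \<inter> W" "y \<in> ?S \<inter> W" using A True by auto
        then obtain z z' where "z \<in> ?S \<inter> W" "r b z" "h z" "z' \<in> ?S \<inter> W" "r b z'" "\<not> h z'"
          using h[of b x y] A by blast
        then show ?thesis by (auto simp: g_def)
      qed
    qed
  qed
qed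


section \<open>The graph of the first step of the algorithm\<close>

lemma del_arcs_within_simps [simp]:
  "verts (del_arcs_within G D) = verts G" "tail (del_arcs_within G D) = tail G"
  "head (del_arcs_within G D) = head G"
  "arcs (del_arcs_within G D) = {e \<in> arcs G. \<not> (tail G e \<in> D \<and> head G e \<in> D)}"
  by (simp_all add: del_arcs_within_def)

lemma nbrs_del_arcs_within:
  "nbrs (del_arcs_within G D) u = {w \<in> nbrs G u. \<not> (u \<in> D \<and> w \<in> D)}"
  by (auto simp: nbrs_def arcs_ends_conv)

lemma (in graph) graph_del_arcs_within: "graph (del_arcs_within G D)"
proof -
  let ?H = "del_arcs_within G D"
  interpret H: wf_digraph ?H by unfold_locales auto
  have "subgraph ?H G"
    by (intro subgraphI) (auto simp: compatible_def H.wf_digraph wf_digraph)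
  then interpret H: digraph ?H by (rule digraph_subgraph)
  have "symmetric ?H"
    unfolding symmetric_conv
  proof
    fix e assume e: "e \<in> arcs ?H"
    then obtain e' where "e' \<in> arcs G" "tail G e = head G e'" "head G e = tail G e'"
      using sym_arcs unfolding symmetric_conv by auto
    with e show "\<exists>e' \<in> arcs ?H. tail ?H e = head ?H e' \<and> head ?H e = tail ?H e'"
      by (intro bexI[of _ e']) auto
  qed
  then show ?thesis by (rule H.graphI)
qed

lemma (in wf_digraph) nbrs_in_verts: "w \<in> nbrs G b \<Longrightarrow> b \<in> verts G \<and> w \<in> verts G"
  by (auto simp: nbrs_def dest: adj_in_verts)

lemma (in sym_digraph) nbrs_sym: "w \<in> nbrs G b \<longleftrightarrow> b \<in> nbrs G w"
  by (auto simp: nbrs_def dest: graph_symmetric)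

section \<open>Components after deleting the edges inside \<open>D\<close>\<close>

context damping_graph
begin

abbreviation comps :: "'a set \<Rightarrow> ('a, 'b) pre_digraph set" where
  "comps D \<equiv> components (del_arcs_within G D)"

lemma graph_comp: "C \<in> comps D \<Longrightarrow> graph C"
proof -
  assume C: "C \<in> comps D"
  interpret H: graph "del_arcs_within G D" by (rule graph_del_arcs_within)
  have ind: "induced_subgraph C (del_arcs_within G D)" using C by (rule H.component_induced)
  interpret C: digraph C using ind by (rule H.digraphI_induced)
  show ?thesis
    using induced_graph_imp_symmetric[OF H.sym_arcs ind] by (rule C.graphI)
qed

lemma verts_comp: "C \<in> comps D \<Longrightarrow> verts C \<subseteq> verts G"
  using sym_digraph.component_induced[of "del_arcs_within G D" C]
    graph.axioms(2)[OF graph_del_arcs_within[of D]]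
  by (auto simp: pseudo_graph_def induced_subgraph_def subgraph_def)

lemma connected_comp: "C \<in> comps D \<Longrightarrow> connected C"
  by (auto simp: components_def pre_digraph.max_subgraph_def)

lemma nbrs_comp:
  assumes "C \<in> comps D" "u \<in> verts C"
  shows "nbrs C u = {w \<in> nbrs G u. \<not> (u \<in> D \<and> w \<in> D)}"
proof -
  interpret H: graph "del_arcs_within G D" by (rule graph_del_arcs_within)
  show ?thesis using H.nbrs_component[OF assms] by (simp add: nbrs_del_arcs_within)
qed

lemma comp_closed:
  assumes "C \<in> comps D" "u \<in> verts C" "w \<in> nbrs G u" "\<not> (u \<in> D \<and> w \<in> D)"
  shows "w \<in> verts C"
proof -
  interpret C: graph C using assms(1) by (rule graph_comp)
  show ?thesis using assms C.nbrs_in_verts[of w u] by (simp add: nbrs_comp)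
qed

lemma finite_comps: "finite (comps D)"
proof -
  interpret H: graph "del_arcs_within G D" by (rule graph_del_arcs_within)
  show ?thesis using H.finite_sccs by (simp add: H.components_eq_sccs)
qed

lemma ex_comp: "v \<in> verts G \<Longrightarrow> \<exists>C \<in> comps D. v \<in> verts C"
proof -
  interpret H: graph "del_arcs_within G D" by (rule graph_del_arcs_within)
  show "v \<in> verts G \<Longrightarrow> ?thesis" using H.scc_for_vert_ex[of v] by (auto simp: H.components_eq_sccs)
qed

text \<open>A component disjoint from \<open>D\<close> loses no edge, so it is closed under
  adjacency in the connected graph \<open>G\<close> and would contain a damped node.\<close>

lemma comp_meets_damped:
  assumes C: "C \<in> comps D" and D: "Vd \<subseteq> D"
  shows "verts C \<inter> D \<noteq> {}"
proof
  assume disj: "verts C \<inter> D = {}"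
  obtain u where u: "u \<in> verts C"
    using connected_comp[OF C] by (auto simp: connected_conv)
  obtain d where d: "d \<in> Vd" using damped_nonempty by blast
  have "u \<rightarrow>\<^sup>*\<^bsub>G\<^esub> d"
    using symmetric_connected_imp_strongly_connected[OF sym_arcs connected] u d
      verts_comp[OF C] damped_subset by (auto simp: strongly_connected_def)
  then have "d \<in> verts C"
  proof (induct rule: reachable_induct)
    case base
    show ?case by (rule u)
  next
    case (step x y)
    then have "y \<in> nbrs G x" by (simp add: nbrs_def)
    then show ?case using comp_closed[OF C \<open>x \<in> verts C\<close>] disj step by blast
  qed
  with d D disj show False by blast
qed

text \<open>Otherwise \<open>P\<close> would propagate along a path from \<open>u\<close> to
  \<open>w\<close>. Applied to blackness, it yields a black node with a non-black neighbor.\<close>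

lemma comp_boundary:
  assumes C: "C \<in> comps D" and P: "u \<in> verts C" "P u" "w \<in> verts C" "\<not> P w"
  shows "\<exists>x \<in> verts C. \<exists>y \<in> nbrs C x. P x \<and> \<not> P y"
proof (rule ccontr)
  assume no: "\<not> ?thesis"
  interpret C: graph C using C by (rule graph_comp)
  have "u \<rightarrow>\<^sup>*\<^bsub>C\<^esub> w"
    using C.symmetric_connected_imp_strongly_connected[OF C.sym_arcs connected_comp[OF C]] P
    by (auto simp: strongly_connected_def)
  then have "P w"
  proof (induct rule: C.reachable_induct)
    case base
    show ?case by (rule P)
  next
    case (step x y)
    then have "y \<in> nbrs C x" by (simp add: nbrs_def)
    then show ?case using no step C.nbrs_in_verts[of y x] by blast
  qed
  with P show False by blast
qed

text \<open>The three notions depend only on which red and blue neighbors a black node has, and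
  every deleted edge joins two black nodes.\<close>

lemma balanced_comp_iff:
  assumes C: "C \<in> comps D" and b: "b \<in> verts C" and black: "\<And>v. v \<in> D \<Longrightarrow> f v = Black"
  shows "poorly_balanced G f b \<longleftrightarrow> poorly_balanced C f b"
    and "richly_balanced G f b \<longleftrightarrow> richly_balanced C f b"
    and "unbalanced G f b \<longleftrightarrow> unbalanced C f b"
proof -
  have nb: "w \<in> nbrs C b \<longleftrightarrow> w \<in> nbrs G b" if "f w \<noteq> Black" for w
    using nbrs_comp[OF C b] that black by blast
  show poorly: "poorly_balanced G f b \<longleftrightarrow> poorly_balanced C f b"
    unfolding poorly_balanced_def using nb by blast
  show richly: "richly_balanced G f b \<longleftrightarrow> richly_balanced C f b"
    unfolding richly_balanced_def using nb by (metis color.distinct(1,3))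
  show "unbalanced G f b \<longleftrightarrow> unbalanced C f b"
    by (simp add: unbalanced_def poorly richly)
qed


section \<open>A successful derived coloring yields a richly balanced coloring\<close>

text \<open>A node outside \<open>C\<close> can be joined to \<open>C\<close> only by an edge inside
  \<open>D\<close>, so all its neighbors are black and it is poorly balanced. Inside
  \<open>C\<close>, balance transfers from the component to \<open>G\<close>.\<close>

lemma renders_of_component:
  assumes C: "C \<in> comps D" and D: "Vd \<subseteq> D" "D \<subseteq> verts G"
    and vals: "\<And>v. f v \<in> {Black, Red, Blue}"
    and black: "\<And>v. v \<in> D \<or> v \<notin> verts C \<Longrightarrow> f v = Black"
    and bal: "\<And>b. b \<in> verts C \<Longrightarrow> \<not> unbalanced C f b"
    and nonblack: "\<exists>v \<in> verts C. f v \<noteq> Black"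
  shows "coloring G Vd f \<and> renders_richly_balanced G f"
proof -
  have "\<not> unbalanced G f b" for b
  proof (cases "b \<in> verts C")
    case True
    then show ?thesis using bal balanced_comp_iff(3)[OF C] black by blast
  next
    case False
    have "f w = Black" if "w \<in> nbrs G b" for w
      using False comp_closed[OF C, of w b] nbrs_sym[of w b] black that by blast
    then show ?thesis by (auto simp: unbalanced_def poorly_balanced_def)
  qed
  moreover have "\<exists>b \<in> verts G. richly_balanced G f b"
  proof -
    obtain d where "d \<in> verts C" "f d = Black"
      using comp_meets_damped[OF C D(1)] black by blast
    then obtain x y where x: "x \<in> verts C" "y \<in> nbrs C x" "f x = Black" "f y \<noteq> Black"
      using comp_boundary[OF C, of d "\<lambda>v. f v = Black"] nonblack by blast
    then have "richly_balanced C f x"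
      using bal[of x] by (auto simp: unbalanced_def poorly_balanced_def)
    with x show ?thesis using balanced_comp_iff(2)[OF C] black verts_comp[OF C] by blast
  qed
  moreover have "coloring G Vd f"
    using vals black D by (auto simp: coloring_def)
  ultimately show ?thesis by (auto simp: renders_richly_balanced_def)
qed

text \<open>
  Every edge at a node left white belongs to the spanning tree, so the white nodes can be split into
  red and blue ones such that no black node with two white neighbors becomes unbalanced. A black node
  with exactly one white neighbor that is not forcing already has neighbors of both colors.
\<close>

lemma derived_coloring_completes:
  assumes C: "C \<in> comps D" and D: "Vd \<subseteq> D" "D \<subseteq> verts G"
    and T: "undirected_spanning_tree T C"
    and black: "\<And>v. v \<in> D \<Longrightarrow> f v = Black"
    and white: "\<And>v. v \<in> verts C \<Longrightarrow> f v = White \<Longrightarrow> v \<notin> chord_nodes C T D"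
    and final: "\<not> (\<exists>f'. forcing_step C f f')"
    and bal: "\<And>b. b \<in> verts C \<Longrightarrow> \<not> unbalanced_partial C f b"
    and nonblack: "\<exists>v \<in> verts C. f v \<noteq> Black"
  shows "\<exists>g. coloring G Vd g \<and> renders_richly_balanced G g"
proof -
  interpret C: graph C using C by (rule graph_comp)
  have sub: "subgraph T C" and vT: "verts T = verts C" and symT: "symmetric T"
    and acyc: "\<not> (\<exists>p. pre_digraph.cycle T p \<and> 3 \<le> length p)"
    using T by (auto simp: undirected_spanning_tree_def spanning_def)
  interpret T: digraph T using sub by (rule C.digraph_subgraph)
  interpret T: graph T using symT by (rule T.graphI)
  define W where "W = {v \<in> verts C. f v = White}"
  have TW: "w \<in> nbrs C b \<longleftrightarrow> b \<rightarrow>\<^bsub>T\<^esub> w" if "w \<in> W" for b w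
  proof
    assume "w \<in> nbrs C b"
    then obtain e where e: "e \<in> arcs C" "tail C e = b" "head C e = w"
      by (auto simp: nbrs_def)
    have "w \<notin> D" "w \<in> verts C" "w \<notin> chord_nodes C T D"
      using that black white by (auto simp: W_def)
    then have "e \<in> arcs T" using e by (auto simp: chord_nodes_def)
    then show "b \<rightarrow>\<^bsub>T\<^esub> w"
      using e sub by (auto simp: arcs_ends_conv subgraph_def compatible_def)
  next
    assume "b \<rightarrow>\<^bsub>T\<^esub> w"
    then show "w \<in> nbrs C b" using C.adj_mono[OF _ sub] by (simp add: nbrs_def)
  qed
  have "\<exists>h :: 'a \<Rightarrow> bool. \<forall>b \<in> verts C - W. \<forall>x \<in> verts C \<inter> W. \<forall>y \<in> verts C \<inter> W.
      b \<rightarrow>\<^bsub>T\<^esub> x \<and> b \<rightarrow>\<^bsub>T\<^esub> y \<and> x \<noteq> y \<longrightarrow>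
      (\<exists>z \<in> verts C \<inter> W. b \<rightarrow>\<^bsub>T\<^esub> z \<and> h z) \<and> (\<exists>z \<in> verts C \<inter> W. b \<rightarrow>\<^bsub>T\<^esub> z \<and> \<not> h z)"
    by (rule two_coloring_by_leaves[OF C.finite_verts T.graph_symmetric], assumption)
      (rule T.exists_leaf[OF acyc], simp_all add: vT)
  then obtain h :: "'a \<Rightarrow> bool" where
    h: "\<forall>b \<in> verts C - W. \<forall>x \<in> verts C \<inter> W. \<forall>y \<in> verts C \<inter> W.
      b \<rightarrow>\<^bsub>T\<^esub> x \<and> b \<rightarrow>\<^bsub>T\<^esub> y \<and> x \<noteq> y \<longrightarrow>
      (\<exists>z \<in> verts C \<inter> W. b \<rightarrow>\<^bsub>T\<^esub> z \<and> h z) \<and> (\<exists>z \<in> verts C \<inter> W. b \<rightarrow>\<^bsub>T\<^esub> z \<and> \<not> h z)"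
    by blast
  define g where
    "g v = (if v \<notin> verts C then Black else if f v = White then if h v then Red else Blue else f v)" for v
  have gf: "g v = f v" if "v \<in> verts C" "v \<notin> W" for v
    using that by (auto simp: g_def W_def)
  have "\<not> unbalanced C g b" if b: "b \<in> verts C" for b
  proof (cases "g b = Black")
    case False
    then show ?thesis by (simp add: unbalanced_def)
  next
    case True
    then have fb: "f b = Black" and bW: "b \<notin> W" using b by (auto simp: g_def W_def split: if_splits)
    have nV: "w \<in> verts C" if "w \<in> nbrs C b" for w using C.nbrs_in_verts that by blast
    \<comment> \<open>The split is by the number of white neighbors of \<open>b\<close>:
      \<open>bal\<close> settles none, \<open>final\<close> settles exactly one, and the
      two-coloring \<open>h\<close> settles at least two.\<close>
    consider (none) "\<forall>w \<in> nbrs C b. w \<notin> W"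
      | (one) w where "{u \<in> nbrs C b. f u = White} = {w}"
      | (two) x y where "x \<in> nbrs C b" "y \<in> nbrs C b" "x \<in> W" "y \<in> W" "x \<noteq> y"
    proof (cases "\<exists>w \<in> nbrs C b. w \<in> W")
      case True
      then obtain w where w: "w \<in> nbrs C b" "w \<in> W" by blast
      show ?thesis
      proof (cases "\<exists>y \<in> nbrs C b. y \<in> W \<and> y \<noteq> w")
        case True
        then show ?thesis using two w by blast
      next
        case False
        moreover have "{u \<in> nbrs C b. f u = White} = {u \<in> nbrs C b. u \<in> W}"
          using nV by (auto simp: W_def)
        ultimately have "{u \<in> nbrs C b. f u = White} = {w}" using w by blast
        then show ?thesis by (rule one)
      qed
    next
      case False
      then show ?thesis using none by blast
    qed
    then show ?thesis
    proof cases
      case none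
      then have gw: "g w = f w" "f w \<noteq> White" if "w \<in> nbrs C b" for w
        using nV gf that by (auto simp: W_def)
      show ?thesis
      proof (cases "(\<exists>w \<in> nbrs C b. f w = Red) \<or> (\<exists>w \<in> nbrs C b. f w = Blue)")
        case True
        then have "(\<exists>w \<in> nbrs C b. f w = Red) \<and> (\<exists>w \<in> nbrs C b. f w = Blue)"
          using bal[OF b] fb gw unfolding unbalanced_partial_def by blast
        then show ?thesis using gw by (fastforce simp: unbalanced_def richly_balanced_def)
      next
        case False
        then have "g w = Black" if "w \<in> nbrs C b" for w
          using gw[OF that] that by (cases "f w") auto
        then show ?thesis by (auto simp: unbalanced_def poorly_balanced_def)
      qed
    next
      case (one w)
      \<comment> \<open>Any other combination of red and blue neighbors would enable one of the
        three forcing rules at \<open>b\<close>.\<close>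
      have "(\<exists>u \<in> nbrs C b. f u = Red) \<and> (\<exists>u \<in> nbrs C b. f u = Blue)"
        using final forcing_step.intros[OF b fb one] by blast
      moreover have "g u = f u" if "f u \<noteq> White" "u \<in> nbrs C b" for u
        using gf nV that by (simp add: W_def)
      ultimately have "richly_balanced C g b"
        using True unfolding richly_balanced_def by (metis color.distinct(9,11))
      then show ?thesis by (simp add: unbalanced_def)
    next
      case (two x y)
      then obtain z z' where "z \<in> W" "z \<in> nbrs C b" "h z" "z' \<in> W" "z' \<in> nbrs C b" "\<not> h z'"
        using bspec[OF bspec[OF bspec[OF h, of b], of x], of y] b bW TW by (auto simp: W_def)
      then have "g z = Red" "g z' = Blue" by (auto simp: g_def W_def)
      then have "richly_balanced C g b"
        using True \<open>z \<in> nbrs C b\<close> \<open>z' \<in> nbrs C b\<close> by (auto simp: richly_balanced_def)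
      then show ?thesis by (simp add: unbalanced_def)
    qed
  qed
  moreover have "g v \<in> {Black, Red, Blue}" for v
    by (cases "f v") (auto simp: g_def)
  moreover have "g v = Black" if "v \<in> D \<or> v \<notin> verts C" for v
    using that black by (auto simp: g_def)
  moreover have "\<exists>v \<in> verts C. g v \<noteq> Black"
    using nonblack by (auto simp: g_def)
  ultimately show ?thesis using renders_of_component[OF C D, of g] by blast
qed

end


section \<open>Forcing reproduces a richly balanced coloring\<close>

text \<open>\<open>White\<close> is read as undetermined: the partial coloring \<open>g\<close>
  records only correct information about \<open>f\<close>.\<close>

definition agrees :: "('a, 'b) pre_digraph \<Rightarrow> ('a \<Rightarrow> color) \<Rightarrow> ('a \<Rightarrow> color) \<Rightarrow> bool" where
  "agrees C f g \<longleftrightarrow> (\<forall>v \<in> verts C. g v \<noteq> White \<longrightarrow> g v = f v)"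

text \<open>The forcing node is black in \<open>f\<close>, too, and not unbalanced there. If its
  neighbors other than \<open>w\<close> are all black, a single colored neighbor would unbalance it,
  so \<open>w\<close> is black; if they show just one of red and blue, \<open>w\<close> must supply
  the other.\<close>

lemma (in wf_digraph) forcing_step_agrees:
  assumes vals: "\<And>v. v \<in> verts G \<Longrightarrow> f v \<in> {Black, Red, Blue}"
    and bal: "\<And>b. b \<in> verts G \<Longrightarrow> \<not> unbalanced G f b"
    and g: "agrees G f g" and step: "forcing_step G g g'"
  shows "agrees G f g'"
  using step
proof cases
  case (black_forcing b w)
  have w: "w \<in> nbrs G b" using black_forcing by blast
  have others: "f u = Black" if "u \<in> nbrs G b" "u \<noteq> w" for u
  proof -
    have "g u \<noteq> White" "g u \<noteq> Red" "g u \<noteq> Blue" using black_forcing that by auto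
    then show ?thesis
      using g nbrs_in_verts[OF that(1)] by (cases "g u") (auto simp: agrees_def)
  qed
  have "f b = Black" using g black_forcing by (auto simp: agrees_def)
  then have "poorly_balanced G f b \<or> richly_balanced G f b"
    using bal[of b] black_forcing by (auto simp: unbalanced_def)
  then have "f w = Black"
    using others w unfolding poorly_balanced_def richly_balanced_def
    by (metis color.distinct(1,3,7))
  then show ?thesis using g black_forcing by (auto simp: agrees_def)
next
  case (blue_forcing b w)
  have others: "f u \<noteq> Blue" if "u \<in> nbrs G b" "u \<noteq> w" for u
  proof -
    have "g u \<noteq> White" "g u \<noteq> Blue" using blue_forcing that by auto
    then show ?thesis using g nbrs_in_verts[OF that(1)] by (auto simp: agrees_def)
  qed
  obtain u where u: "u \<in> nbrs G b" "f u = Red"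
    using blue_forcing g nbrs_in_verts unfolding agrees_def by (metis color.distinct(9))
  have "f b = Black" using g blue_forcing by (auto simp: agrees_def)
  then have "richly_balanced G f b"
    using bal[of b] blue_forcing u by (auto simp: unbalanced_def poorly_balanced_def)
  then have "f w = Blue"
    using others unfolding richly_balanced_def by metis
  then show ?thesis using g blue_forcing by (auto simp: agrees_def)
next
  case (red_forcing b w)
  have others: "f u \<noteq> Red" if "u \<in> nbrs G b" "u \<noteq> w" for u
  proof -
    have "g u \<noteq> White" "g u \<noteq> Red" using red_forcing that by auto
    then show ?thesis using g nbrs_in_verts[OF that(1)] by (auto simp: agrees_def)
  qed
  obtain u where u: "u \<in> nbrs G b" "f u = Blue"
    using red_forcing g nbrs_in_verts unfolding agrees_def by (metis color.distinct(11))
  have "f b = Black" using g red_forcing by (auto simp: agrees_def)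
  then have "richly_balanced G f b"
    using bal[of b] red_forcing u by (auto simp: unbalanced_def poorly_balanced_def)
  then have "f w = Red"
    using others unfolding richly_balanced_def by metis
  then show ?thesis using g red_forcing by (auto simp: agrees_def)
qed

text \<open>A node that is unbalanced in the partial sense has no white neighbors, so
  \<open>f\<close> and \<open>g\<close> coincide around it and it is unbalanced in \<open>f\<close>
  as well.\<close>

lemma (in wf_digraph) agrees_imp_balanced:
  assumes bal: "\<not> unbalanced G f b" and b: "b \<in> verts G" and g: "agrees G f g"
  shows "\<not> unbalanced_partial G g b"
proof
  assume ub: "unbalanced_partial G g b"
  then have eq: "f u = g u" if "u \<in> nbrs G b" for u
    using g nbrs_in_verts[OF that] that by (auto simp: agrees_def unbalanced_partial_def)
  have "f b = Black" using g ub b by (auto simp: agrees_def unbalanced_partial_def)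
  moreover have "\<not> poorly_balanced G f b" "\<not> richly_balanced G f b"
    using ub eq unfolding unbalanced_partial_def poorly_balanced_def richly_balanced_def
    by (metis color.distinct(1,3))+
  ultimately have "unbalanced G f b" by (simp add: unbalanced_def)
  with bal show False ..
qed

lemma zero_forcing_step_nbr:
  "zero_forcing_step G B B' \<Longrightarrow> \<exists>b w. b \<in> B \<and> w \<in> nbrs G b \<and> w \<notin> B \<and> nbrs G b - B = {w} \<and> B' = insert w B"
  by (erule zero_forcing_step.cases) blast

text \<open>Forgets which rule was applied: some invariants and the termination measure only need
  that a white node receives a proper color.\<close>

lemma forcing_step_white:
  "forcing_step C g g' \<Longrightarrow> \<exists>b \<in> verts C. \<exists>w \<in> nbrs C b. \<exists>c. g w = White \<and> c \<noteq> White \<and> g' = g(w := c)"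
  by (erule forcing_step.cases) blast+

context damping_graph
begin

abbreviation rich :: "('a \<Rightarrow> color) \<Rightarrow> bool" where
  "rich f \<equiv> coloring G Vd f \<and> renders_richly_balanced G f"

text \<open>One non-black neighbor cannot supply both red and blue, so a black node whose other
  neighbors are all black would be unbalanced.\<close>

lemma zero_forcing_step_black:
  assumes f: "rich f" and B: "\<And>v. v \<in> B \<Longrightarrow> f v = Black"
    and step: "zero_forcing_step G B B'" and v: "v \<in> B'"
  shows "f v = Black"
proof (rule ccontr)
  obtain b w where b: "b \<in> B" "w \<in> nbrs G b" "nbrs G b - B = {w}" "B' = insert w B"
    using zero_forcing_step_nbr[OF step] by blast
  assume "f v \<noteq> Black"
  then have w: "f w \<noteq> Black" using v b B by auto
  have "f u = Black" if "u \<in> nbrs G b" "u \<noteq> w" for u using that b B by blast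
  then have "\<not> richly_balanced G f b"
    unfolding richly_balanced_def by (metis color.distinct(1,3,7))
  then have "unbalanced G f b"
    using b B w by (auto simp: unbalanced_def poorly_balanced_def)
  moreover have "b \<in> verts G" using b nbrs_in_verts by blast
  ultimately show False using f by (auto simp: renders_richly_balanced_def)
qed

definition nonblack_in :: "('a \<Rightarrow> color) \<Rightarrow> ('a, 'b) pre_digraph \<Rightarrow> bool" where
  "nonblack_in f C \<longleftrightarrow> (\<exists>v \<in> verts C. f v \<noteq> Black)"

text \<open>Starts the search invariant when zero forcing ends: some component still to be visited
  can reveal \<open>f\<close>.\<close>

lemma rich_nonblack_comp:
  assumes "rich f"
  shows "\<exists>C \<in> comps D. nonblack_in f C"
proof -
  obtain b v where "v \<in> nbrs G b" "f v = Red"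
    using assms by (auto simp: renders_richly_balanced_def richly_balanced_def)
  moreover from this obtain C where "C \<in> comps D" "v \<in> verts C"
    using ex_comp nbrs_in_verts by blast
  ultimately show ?thesis unfolding nonblack_in_def by (metis color.distinct(1))
qed

lemma rich_balanced_comp:
  assumes f: "rich f" and black: "\<And>v. v \<in> D \<Longrightarrow> f v = Black" and C: "C \<in> comps D"
    and b: "b \<in> verts C"
  shows "\<not> unbalanced C f b"
  using f b verts_comp[OF C] balanced_comp_iff(3)[OF C b, of f] black
  by (auto simp: renders_richly_balanced_def)

text \<open>Used contrapositively: if a derived coloring fails the test, it agrees with no richly
  balanced coloring that is not all black on \<open>C\<close>, so its combination may be
  discarded.\<close>

lemma rich_agrees_success:
  assumes f: "rich f" and black: "\<And>v. v \<in> D \<Longrightarrow> f v = Black" and C: "C \<in> comps D"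
    and nonblack: "nonblack_in f C" and g: "agrees C f g"
  shows "\<not> (\<exists>b \<in> verts C. unbalanced_partial C g b) \<and> \<not> (\<forall>v \<in> verts C. g v = Black)"
proof -
  interpret C: graph C using C by (rule graph_comp)
  have "\<not> (\<exists>b \<in> verts C. unbalanced_partial C g b)"
    using C.agrees_imp_balanced[OF rich_balanced_comp[OF f black C] _ g] by blast
  moreover have "\<not> (\<forall>v \<in> verts C. g v = Black)"
    using nonblack g by (fastforce simp: nonblack_in_def agrees_def)
  ultimately show ?thesis ..
qed

lemma rich_agrees_step:
  assumes f: "rich f" and black: "\<And>v. v \<in> D \<Longrightarrow> f v = Black" and C: "C \<in> comps D"
    and g: "agrees C f g" "forcing_step C g g'"
  shows "agrees C f g'"
proof -
  interpret C: graph C using C by (rule graph_comp)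
  have "f v \<in> {Black, Red, Blue}" if "v \<in> verts C" for v
    using f that verts_comp[OF C] by (auto simp: coloring_def)
  then show ?thesis
    using rich_balanced_comp[OF f black C] g by (rule C.forcing_step_agrees)
qed


section \<open>Invariant and termination of the algorithm\<close>

definition loop_inv :: "'a set \<Rightarrow> ('a, 'b) pre_digraph set \<Rightarrow> bool" where
  "loop_inv D Cs \<longleftrightarrow> Vd \<subseteq> D \<and> D \<subseteq> verts G \<and> Cs \<subseteq> comps D \<and>
     (\<forall>f. rich f \<longrightarrow> (\<forall>v \<in> D. f v = Black))"

text \<open>A configuration stores the chord nodes but not the tree they come from, hence the
  existential quantifier over \<open>T\<close>.\<close>

definition comp_inv :: "'a set \<Rightarrow> ('a, 'b) pre_digraph set \<Rightarrow> ('a, 'b) pre_digraph \<Rightarrow> 'a set \<Rightarrow>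
    ('a \<Rightarrow> color) set \<Rightarrow> bool" where
  "comp_inv D Cs C Vc K \<longleftrightarrow> loop_inv D Cs \<and> C \<in> comps D \<and> K \<subseteq> Vc \<rightarrow>\<^sub>E {Black, Blue, Red} \<and>
     (\<exists>T. undirected_spanning_tree T C \<and> Vc = chord_nodes C T D)"

text \<open>For every richly balanced \<open>f\<close>, the search space left contains a witness: an
  unvisited component that \<open>f\<close> does not color all black, or the current one with the
  combination given by \<open>f\<close> untried or in progress. With no component left, no
  \<open>f\<close> exists. That \<open>D\<close> and \<open>Vc\<close> contain no white node keeps
  white nodes off the chords.\<close>

fun invariant :: "('a, 'b) config \<Rightarrow> bool" where
  "invariant (Zero_Forcing B) \<longleftrightarrow> Vd \<subseteq> B \<and> B \<subseteq> verts G \<and> (\<forall>f. rich f \<longrightarrow> (\<forall>v \<in> B. f v = Black))"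
| "invariant (Component_Loop D Cs) \<longleftrightarrow> loop_inv D Cs \<and>
     (\<forall>f. rich f \<longrightarrow> (\<exists>C' \<in> Cs. nonblack_in f C'))"
| "invariant (Combination_Loop D Cs C Vc K) \<longleftrightarrow> comp_inv D Cs C Vc K \<and>
     (\<forall>f. rich f \<longrightarrow> (\<exists>C' \<in> Cs. nonblack_in f C') \<or> nonblack_in f C \<and> restrict f Vc \<in> K)"
| "invariant (Color_Forcing D Cs C Vc K g) \<longleftrightarrow> comp_inv D Cs C Vc K \<and>
     (\<forall>v \<in> D. g v = Black) \<and> (\<forall>v \<in> Vc. g v \<noteq> White) \<and>
     (\<forall>f. rich f \<longrightarrow> (\<exists>C' \<in> Cs. nonblack_in f C') \<or>
       nonblack_in f C \<and> (restrict f Vc \<in> K \<or> agrees C f g))"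
| "invariant (Returned r) \<longleftrightarrow> r = (if \<exists>f. rich f then Not_PI_GAS else PI_GAS)"

lemma finite_combinations:
  assumes "comp_inv D Cs C Vc K"
  shows "finite K"
proof -
  have C: "C \<in> comps D" and K: "K \<subseteq> Vc \<rightarrow>\<^sub>E {Black, Blue, Red}" and "Vc \<subseteq> verts C"
    using assms by (auto simp: comp_inv_def chord_nodes_def)
  moreover have "finite (verts C)"
    using verts_comp[OF C] finite_verts by (rule finite_subset)
  ultimately have "finite (Vc \<rightarrow>\<^sub>E {Black, Blue, Red})"
    by (intro finite_PiE) (auto intro: finite_subset)
  with K show ?thesis by (rule finite_subset)
qed

section \<open>Preservation of the invariant\<close>

lemma invariant_init: "invariant (Zero_Forcing Vd)"
  using damped_subset by (auto simp: coloring_def)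

lemma invariant_next_component:
  assumes inv: "invariant (Component_Loop D Cs)" and C: "C \<in> Cs"
    and T: "undirected_spanning_tree T C" and Vc: "Vc = chord_nodes C T D"
  shows "invariant (Combination_Loop D (Cs - {C}) C Vc (Vc \<rightarrow>\<^sub>E {Black, Blue, Red}))"
proof -
  have CD: "C \<in> comps D" using inv C by (auto simp: loop_inv_def)
  then have "Vc \<subseteq> verts G" using verts_comp by (auto simp: Vc chord_nodes_def)
  \<comment> \<open>If \<open>C\<close> was the witness for \<open>f\<close>, the witness is now the
    combination that \<open>f\<close> itself induces on the chord nodes.\<close>
  then have "restrict f Vc \<in> Vc \<rightarrow>\<^sub>E {Black, Blue, Red}" if "rich f" for f
    using that by (fastforce simp: coloring_def)
  moreover have "comp_inv D (Cs - {C}) C Vc (Vc \<rightarrow>\<^sub>E {Black, Blue, Red})"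
    using inv CD T Vc by (auto simp: comp_inv_def loop_inv_def)
  ultimately show ?thesis using inv by auto
qed

lemma invariant_next_combination:
  assumes inv: "invariant (Combination_Loop D Cs C Vc K)" and k: "k \<in> K"
  shows "invariant (Color_Forcing D Cs C Vc (K - {k}) (initial_coloring D Vc k))"
proof -
  have "k \<in> Vc \<rightarrow>\<^sub>E {Black, Blue, Red}"
    using inv k by (auto simp: comp_inv_def)
  then have "k v \<noteq> White" if "v \<in> Vc" for v
    using PiE_mem[OF _ that] by fastforce
  then have "\<forall>v \<in> Vc. initial_coloring D Vc k v \<noteq> White"
    by (simp add: initial_coloring_def)
  \<comment> \<open>When the combination removed from \<open>K\<close> is the one induced by
    \<open>f\<close>, the witness passes to the current coloring; \<open>f\<close> is black on
    \<open>D\<close> by the invariant.\<close>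
  moreover have "agrees C f (initial_coloring D Vc k)" if f: "rich f" "restrict f Vc = k" for f
  proof -
    have "f v = Black" if "v \<in> D" for v
      using inv f that by (auto simp: comp_inv_def loop_inv_def)
    then show ?thesis using f(2) by (auto simp: agrees_def initial_coloring_def)
  qed
  moreover have "comp_inv D Cs C Vc (K - {k})" using inv by (auto simp: comp_inv_def)
  ultimately show ?thesis using inv by (auto simp: initial_coloring_def)
qed

lemma invariant_color_force:
  assumes inv: "invariant (Color_Forcing D Cs C Vc K g)" and step: "forcing_step C g g'"
  shows "invariant (Color_Forcing D Cs C Vc K g')"
proof -
  have "agrees C f g'" if "rich f" "agrees C f g" for f
    using that inv step rich_agrees_step[of f D C g g'] by (auto simp: comp_inv_def loop_inv_def)
  moreover obtain w c where "g w = White" "c \<noteq> White" "g' = g(w := c)"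
    using forcing_step_white[OF step] by blast
  ultimately show ?thesis using inv by auto
qed

lemma invariant_success:
  assumes inv: "invariant (Color_Forcing D Cs C Vc K g)" and final: "\<not> (\<exists>g'. forcing_step C g g')"
    and succ: "\<not> (\<exists>b \<in> verts C. unbalanced_partial C g b) \<and> \<not> (\<forall>v \<in> verts C. g v = Black)"
  shows "invariant (Returned Not_PI_GAS)"
proof -
  obtain T where T: "undirected_spanning_tree T C" and Vc: "Vc = chord_nodes C T D"
    and C: "C \<in> comps D" and D: "Vd \<subseteq> D" "D \<subseteq> verts G"
    using inv by (auto simp: comp_inv_def loop_inv_def)
  have "\<exists>f. rich f"
    by (rule derived_coloring_completes[OF C D T _ _ final]) (use inv succ Vc in auto)
  then show ?thesis by simp
qed

lemma invariant_failure:
  assumes inv: "invariant (Color_Forcing D Cs C Vc K g)"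
    and failed: "\<not> (\<not> (\<exists>b \<in> verts C. unbalanced_partial C g b) \<and> \<not> (\<forall>v \<in> verts C. g v = Black))"
  shows "invariant (Combination_Loop D Cs C Vc K)"
proof -
  have "\<not> agrees C f g" if "rich f" "nonblack_in f C" for f
    using that inv failed rich_agrees_success[of f D C g] by (auto simp: comp_inv_def loop_inv_def)
  then show ?thesis using inv by auto
qed

lemma invariant_step:
  assumes "cnc_step G c c'" "invariant c"
  shows "invariant c'"
  using assms
proof cases
  case (zero_force B B')
  have "v \<in> verts G" if "v \<in> B'" for v
    using zero_force assms(2) that zero_forcing_step_nbr[of G B B'] nbrs_in_verts by auto
  moreover have "B \<subseteq> B'"
    using zero_force zero_forcing_step_nbr[of G B B'] by auto
  ultimately show ?thesis
    using zero_force assms(2) zero_forcing_step_black[of _ B B'] by auto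
next
  case (zero_forcing_done D)
  then show ?thesis
    using assms(2) rich_nonblack_comp by (auto simp: loop_inv_def)
next
  case (next_component C Cs T Vc D)
  then show ?thesis using assms(2) invariant_next_component by blast
next
  case (components_done D)
  then show ?thesis using assms(2) by auto
next
  case (next_combination k K D Cs C Vc)
  then show ?thesis using assms(2) invariant_next_combination by blast
next
  case (combinations_done D Cs C Vc)
  then show ?thesis using assms(2) by (auto simp: comp_inv_def)
next
  case (color_force C g g' D Cs Vc K)
  then show ?thesis using assms(2) invariant_color_force by blast
next
  case (derived_success C g D Cs Vc K)
  then show ?thesis using assms(2) invariant_success by blast
next
  case (derived_failure C g D Cs Vc K)
  then show ?thesis using assms(2) invariant_failure by blast
qed

section \<open>Termination, progress and total correctness\<close>

fun zero_forcing_rank :: "('a, 'b) config \<Rightarrow> nat" where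
  "zero_forcing_rank (Zero_Forcing B) = Suc (card (verts G - B))"
| "zero_forcing_rank _ = 0"

fun component_rank :: "('a, 'b) config \<Rightarrow> nat" where
  "component_rank (Component_Loop D Cs) = card Cs"
| "component_rank (Combination_Loop D Cs C Vc K) = card Cs"
| "component_rank (Color_Forcing D Cs C Vc K g) = card Cs"
| "component_rank _ = 0"

text \<open>The offsets 1 and 2 make the rank drop when the last combination is done and when the
  empty component loop returns; \<open>component_rank\<close> is unchanged in both cases.\<close>

fun combination_rank :: "('a, 'b) config \<Rightarrow> nat" where
  "combination_rank (Component_Loop D Cs) = 1"
| "combination_rank (Combination_Loop D Cs C Vc K) = 2 + card K"
| "combination_rank (Color_Forcing D Cs C Vc K g) = 2 + card K"
| "combination_rank _ = 0"

text \<open>The \<open>Suc\<close> makes returning to the combination loop a decrease even if no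
  white node is left.\<close>

fun forcing_rank :: "('a, 'b) config \<Rightarrow> nat" where
  "forcing_rank (Color_Forcing D Cs C Vc K g) = Suc (card {v \<in> verts C. g v = White})"
| "forcing_rank _ = 0"

text \<open>The ranks are compared lexicographically, outermost phase first. The invariant supplies
  finiteness of \<open>Cs\<close> and \<open>K\<close>, so that removing an element lowers the
  cardinality.\<close>

lemma cnc_step_decreases:
  assumes "cnc_step G c c'" "invariant c"
  shows "(c', c) \<in> measures [zero_forcing_rank, component_rank, combination_rank, forcing_rank]"
  using assms
proof cases
  case (zero_force B B')
  then obtain w where "w \<in> verts G" "w \<notin> B" "B' = insert w B"
    using zero_forcing_step_nbr[of G B B'] nbrs_in_verts by blast
  then have "verts G - B' \<subset> verts G - B" by auto
  then have "card (verts G - B') < card (verts G - B)"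
    by (intro psubset_card_mono) auto
  then show ?thesis using zero_force by simp
next
  case (next_component C Cs T Vc D)
  then have "finite Cs" "C \<in> Cs"
    using assms(2) finite_comps by (auto simp: loop_inv_def intro: finite_subset)
  then have "card (Cs - {C}) < card Cs" by (rule card_Diff1_less)
  then show ?thesis using next_component by simp
next
  case (next_combination k K D Cs C Vc)
  then have "finite K" "k \<in> K"
    using assms(2) finite_combinations by auto
  then have "card (K - {k}) < card K" by (rule card_Diff1_less)
  then show ?thesis using next_combination by simp
next
  case (color_force C g g' D Cs Vc K)
  then have "C \<in> comps D" using assms(2) by (auto simp: comp_inv_def)
  then interpret C: graph C by (rule graph_comp)
  obtain w c where "w \<in> verts C" "g w = White" "c \<noteq> White" "g' = g(w := c)"
    using color_force forcing_step_white[of C g g'] C.nbrs_in_verts by blast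
  then have "{v \<in> verts C. g' v = White} \<subset> {v \<in> verts C. g v = White}" by auto
  then have "card {v \<in> verts C. g' v = White} < card {v \<in> verts C. g v = White}"
    by (intro psubset_card_mono) auto
  then show ?thesis using color_force by simp
qed auto

text \<open>The component loop cannot get stuck because every component has a spanning tree; in the
  other phases a rule and its exit cover all cases.\<close>

lemma cnc_progress:
  assumes inv: "invariant c" and stuck: "\<not> (\<exists>c'. cnc_step G c c')"
  shows "\<exists>r. c = Returned r"
proof (cases c)
  case (Zero_Forcing B)
  then show ?thesis using stuck zero_force zero_forcing_done by blast
next
  case (Component_Loop D Cs)
  show ?thesis
  proof (cases "Cs = {}")
    case True
    then show ?thesis using stuck Component_Loop components_done by blast
  next
    case False
    then obtain C where C: "C \<in> Cs" "C \<in> comps D"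
      using inv Component_Loop by (auto simp: loop_inv_def)
    then interpret C: graph C using graph_comp by blast
    obtain T where "undirected_spanning_tree T C"
      using C.exists_undirected_spanning_tree connected_comp C by blast
    then show ?thesis using stuck Component_Loop C next_component by blast
  qed
next
  case (Combination_Loop D Cs C Vc K)
  then show ?thesis
    using stuck next_combination combinations_done by (cases "K = {}") blast+
next
  case (Color_Forcing D Cs C Vc K g)
  then show ?thesis
    using stuck color_force derived_success derived_failure by metis
qed simp

text \<open>An infinite run would be an infinite descent in a well-founded measure. A run that
  cannot continue has returned some answer, and the invariant determines which.\<close>

lemma cnc_correct:
  "cnc_returns G Vd (if \<exists>f. rich f then Not_PI_GAS else PI_GAS)"
  unfolding cnc_returns_def
proof (intro conjI notI allI impI)
  assume "\<exists>s. s 0 = Zero_Forcing Vd \<and> (\<forall>n. cnc_step G (s n) (s (Suc n)))"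
  then obtain s where s: "s 0 = Zero_Forcing Vd" "\<And>n. cnc_step G (s n) (s (Suc n))" by blast
  have "invariant (s n)" for n
    by (induct n) (use s invariant_init invariant_step in auto)
  then have "(s (Suc n), s n) \<in> measures [zero_forcing_rank, component_rank, combination_rank, forcing_rank]" for n
    using s(2) cnc_step_decreases by blast
  then show False using wf_measures wf_iff_no_infinite_down_chain by blast
next
  fix c
  assume c: "(cnc_step G)\<^sup>*\<^sup>* (Zero_Forcing Vd) c \<and> \<not> (\<exists>c'. cnc_step G c c')"
  then have "(cnc_step G)\<^sup>*\<^sup>* (Zero_Forcing Vd) c" ..
  then have "invariant c"
    by induct (use invariant_init invariant_step in auto)
  moreover from this obtain r where "c = Returned r" using c cnc_progress by blast
  ultimately show "c = Returned (if \<exists>f. rich f then Not_PI_GAS else PI_GAS)" by simp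
qed

end

theorem theorem5p14:
  fixes G :: "('a, 'b) pre_digraph" and Vd :: "'a set"
  assumes "damping_graph G Vd"
  shows "((\<exists>f. coloring G Vd f \<and> renders_richly_balanced G f) \<longrightarrow> cnc_returns G Vd Not_PI_GAS) \<and>
         (\<not> (\<exists>f. coloring G Vd f \<and> renders_richly_balanced G f) \<longrightarrow> cnc_returns G Vd PI_GAS)"
  using damping_graph.cnc_correct[OF assms] by (intro conjI impI) (simp_all only: if_True if_False)

end
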